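(* Let $x^{*}$ be a solution (i.e. an optimal solution) of the problem $(P_0)$: $\min_{x\in R^n}\|x\|_0$ subject to $\|y-Ax\|_2\le\epsilon$, $Bx\le b$, and let $S$ be the support of $x^{*}$. Let $\Lambda$ be the set of all optimal solutions of $(P_0)$, and for feasible $x$ let $I(x)$ be the index set of the active constraints of $Bx\le b$ at $x$. If $|I(x^{*})|=\max\{|I(x)|: x\in\Lambda\}$, then the matrix $$M^{*}=\begin{bmatrix}A_S\\ B_{I,S}\end{bmatrix},\qquad I=I(x^{*}),$$ has full column rank.
   Context: Data: $A\in R^{m\times n}$, $B\in R^{l\times n}$ with $m\ll n$ (in particular $m<n$) and $l\le n$; $y\in R^m$, $b\in R^l$ are given vectors and $\epsilon\ge 0$ is a given parameter. $\|x\|_0$ is the number of nonzero components of $x$; $\|\cdot\|_2$ is the Euclidean norm; $Bx\le b$ is understood componentwise. The feasible set is $T=\{x:\|y-Ax\|_2\le\epsilon,\ Bx\le b\}$. If $k$ is the optimal value of $(P_0)$, then $\Lambda=\{x\in R^n:\|x\|_0=k,\ x\in T\}$. The support of $x$ is $\mathrm{supp}(x)=\{i:x_i\neq0\}$. The active index set is $I(x)=\{j\in\{1,\dots,l\}:(Bx)_j=b_j\}$ and $|I(x)|$ is its cardinality. For an index set $S$ of columns, $A_S$ is the submatrix of $A$ consisting of the columns indexed by $S$; $B_{I,S}$ is the submatrix of $B$ with rows indexed by $I$ and columns indexed by $S$. *)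

theory Defs
  imports
    "HOL-Analysis.L2_Norm"
    "Jordan_Normal_Form.DL_Rank"
    "Jordan_Normal_Form.DL_Submatrix"
begin

text \<open>Vectors and matrices are those of \<^theory>\<open>Jordan_Normal_Form.Matrix\<close>; indices start at 0.\<close>

definition supp :: "real vec \<Rightarrow> nat set" where
  "supp x = {i. i < dim_vec x \<and> x $ i \<noteq> 0}"

definition l0_norm :: "real vec \<Rightarrow> nat" where
  "l0_norm x = card (supp x)"

definition l2_norm :: "real vec \<Rightarrow> real" where
  "l2_norm v = L2_set (\<lambda>i. v $ i) {..<dim_vec v}"

text \<open>The order on vectors is componentwise.\<close>

definition feasible :: "real mat \<Rightarrow> real mat \<Rightarrow> real vec \<Rightarrow> real vec \<Rightarrow> real \<Rightarrow> real vec set" where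
  "feasible A B y b \<epsilon> =
     {x \<in> carrier_vec (dim_col A). l2_norm (y - A *\<^sub>v x) \<le> \<epsilon> \<and> B *\<^sub>v x \<le> b}"

definition P0_solution ::
  "real mat \<Rightarrow> real mat \<Rightarrow> real vec \<Rightarrow> real vec \<Rightarrow> real \<Rightarrow> real vec \<Rightarrow> bool" where
  "P0_solution A B y b \<epsilon> x \<longleftrightarrow> is_arg_min l0_norm (\<lambda>z. z \<in> feasible A B y b \<epsilon>) x"

text \<open>The infimum is taken over natural numbers, so it is attained whenever the problem is feasible.\<close>

definition P0_value :: "real mat \<Rightarrow> real mat \<Rightarrow> real vec \<Rightarrow> real vec \<Rightarrow> real \<Rightarrow> nat" where
  "P0_value A B y b \<epsilon> = (INF x\<in>feasible A B y b \<epsilon>. l0_norm x)"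

definition optimal_set ::
  "real mat \<Rightarrow> real mat \<Rightarrow> real vec \<Rightarrow> real vec \<Rightarrow> real \<Rightarrow> real vec set" where
  "optimal_set A B y b \<epsilon> = {x \<in> feasible A B y b \<epsilon>. l0_norm x = P0_value A B y b \<epsilon>}"

definition active :: "real mat \<Rightarrow> real vec \<Rightarrow> real vec \<Rightarrow> nat set" where
  "active B b x = {j. j < dim_row B \<and> (B *\<^sub>v x) $ j = b $ j}"

text \<open>The operation \<^const>\<open>vec_space.rank\<close> takes the dimension of the ambient space of the
  columns as its first argument.\<close>

definition full_column_rank :: "real mat \<Rightarrow> bool" where
  "full_column_rank M \<longleftrightarrow> vec_space.rank (dim_row M) M = dim_col M"

end

theory Submission
  imports Defs
begin

text \<open>Suppose that \<open>M\<^sup>*\<close> has a nontrivial kernel vector and let \<open>d\<close> be its extension by zeros, so that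
  \<open>A d = 0\<close>, \<open>(B d)\<^sub>j = 0\<close> for \<open>j \<in> I\<close> and \<open>supp d \<subseteq> S\<close>. A multiple \<open>e\<close> of \<open>d\<close> cancels an entry
  of \<open>x\<^sup>*\<close> in \<open>S\<close>, so \<open>x\<^sup>* + e\<close> is sparser than \<open>x\<^sup>*\<close>, hence infeasible. Therefore the segment
  from \<open>x\<^sup>*\<close> to \<open>x\<^sup>* + e\<close> leaves the feasible set, and it does so at a point where a further
  inequality has become active; that point is again optimal, which contradicts the maximality of
  \<open>card I\<close>.\<close>

section \<open>Full column rank and kernels of submatrices\<close>

text \<open>The linear independence used here concerns the set of columns, in which equal columns
  collapse. Distinctness is therefore shown first: two equal columns would put a difference of unit
  vectors into the kernel.\<close>

lemma full_column_rankI: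
  assumes "\<And>v. v \<in> carrier_vec (dim_col M) \<Longrightarrow> M *\<^sub>v v = 0\<^sub>v (dim_row M) \<Longrightarrow> v = 0\<^sub>v (dim_col M)"
  shows "full_column_rank M"
proof -
  let ?n = "dim_col M"
  have M: "M \<in> carrier_mat (dim_row M) ?n" by simp
  have col: "M *\<^sub>v unit_vec ?n k = col M k" if "k < ?n" for k
    using that by (intro eq_vecI) auto
  have "distinct (cols M)"
  proof (rule ccontr)
    assume "\<not> distinct (cols M)"
    then obtain i j where ij: "i < ?n" "j < ?n" "i \<noteq> j" "col M i = col M j"
      by (auto simp: distinct_conv_nth)
    let ?v = "unit_vec ?n i - unit_vec ?n j :: real vec"
    have "M *\<^sub>v ?v = M *\<^sub>v unit_vec ?n i - M *\<^sub>v unit_vec ?n j"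
      by (rule mult_minus_distrib_mat_vec[OF M]) auto
    also have "\<dots> = col M i - col M j"
      using col ij(1,2) by simp
    finally have "M *\<^sub>v ?v = 0\<^sub>v (dim_row M)" using ij by auto
    then have "?v = 0\<^sub>v ?n" by (intro assms) auto
    then have "?v $ i = 0" using ij by simp
    then show False using ij by simp
  qed
  moreover from this have "\<not> LinearCombinations.module.lin_dep class_ring
      (module_vec TYPE(real) (dim_row M)) (set (cols M))"
    using vec_space.lin_depE[OF M] assms by metis
  ultimately show ?thesis
    unfolding full_column_rank_def using vec_space.lin_indpt_full_rank[OF M] by blast
qed

text \<open>The number of elements of \<open>S\<close> below \<open>k\<close> is the position of
  \<open>k\<close> in the increasing enumeration \<open>pick S\<close>, hence the index of the
  submatrix column that stems from column \<open>k\<close>.\<close>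

definition extend_vec :: "nat \<Rightarrow> nat set \<Rightarrow> 'a::zero vec \<Rightarrow> 'a vec" where
  "extend_vec n S v = vec n (\<lambda>k. if k \<in> S then v $ card {a \<in> S. a < k} else 0)"

lemma extend_vec_carrier [simp]: "extend_vec n S v \<in> carrier_vec n"
  by (simp add: extend_vec_def)

lemma supp_extend_vec_subset: "supp (extend_vec n S v) \<subseteq> S"
  by (auto simp: supp_def extend_vec_def split: if_splits)

lemma supp_extend_vec_nonempty:
  assumes "S \<subseteq> {..<n}" "v \<in> carrier_vec (card S)" "v \<noteq> 0\<^sub>v (card S)"
  shows "supp (extend_vec n S v) \<noteq> {}"
proof -
  obtain j where j: "j < card S" "v $ j \<noteq> 0"
    using assms(2,3) by (metis carrier_vecD eq_vecI index_zero_vec)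
  then have "pick S j \<in> S" "card {a \<in> S. a < pick S j} = j"
    using pick_in_set_le card_pick_le by blast+
  with j assms(1) have "pick S j \<in> supp (extend_vec n S v)"
    by (auto simp: supp_def extend_vec_def)
  then show ?thesis by blast
qed

lemma dim_col_submatrix_subset:
  assumes "S \<subseteq> {..<dim_col M}"
  shows "dim_col (submatrix M I S) = card S"
proof -
  have "{j. j < dim_col M \<and> j \<in> S} = S" using assms by auto
  then show ?thesis by (simp only: dim_submatrix)
qed

text \<open>Zeros outside \<open>S\<close> remove the columns that the submatrix drops, and
  \<open>pick S\<close> matches the remaining terms of the two sums. Row \<open>i\<close> reappears
  at its rank within \<open>I\<close>.\<close>

lemma submatrix_mult_vec_index:
  fixes M :: "'a::semiring_0 mat"
  assumes S: "S \<subseteq> {..<dim_col M}" and v: "v \<in> carrier_vec (card S)"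
    and i: "i \<in> I" "i < dim_row M"
  shows "card {a \<in> I. a < i} < dim_row (submatrix M I S)"
    and "(submatrix M I S *\<^sub>v v) $ card {a \<in> I. a < i}
      = (M *\<^sub>v extend_vec (dim_col M) S v) $ i"
proof -
  let ?N = "submatrix M I S" and ?r = "card {a \<in> I. a < i}"
  \<comment> \<open>The inclusion is strict because \<open>i\<close> lies only in the larger set;
    this makes the rank of \<open>i\<close> a valid row index.\<close>
  have "{a \<in> I. a < i} \<subset> {a. a < dim_row M \<and> a \<in> I}" using i by auto
  then show r: "?r < dim_row ?N"
    unfolding dim_submatrix by (intro psubset_card_mono) auto
  have c: "dim_col ?N = card S" using S by (rule dim_col_submatrix_subset)
  \<comment> \<open>Counting the smaller elements of \<open>S\<close> inverts the
    enumeration.\<close>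
  have bij: "bij_betw (pick S) {..<card S} S"
  proof (rule bij_betwI[where g = "\<lambda>k. card {a \<in> S. a < k}"])
    have "finite S" using S finite_subset by blast
    then show "(\<lambda>k. card {a \<in> S. a < k}) \<in> S \<rightarrow> {..<card S}"
      by (auto intro!: psubset_card_mono)
  qed (auto simp: pick_in_set_le card_pick_le pick_card_in_set)
  have "(?N *\<^sub>v v) $ ?r = (\<Sum>j<card S. ?N $$ (?r, j) * v $ j)"
    using r c v by (simp add: scalar_prod_def atLeast0LessThan)
  also have "\<dots> = (\<Sum>j<card S. M $$ (i, pick S j) * extend_vec (dim_col M) S v $ pick S j)"
  proof (rule sum.cong[OF refl])
    fix j assume "j \<in> {..<card S}"
    then have j: "pick S j \<in> S" "card {a \<in> S. a < pick S j} = j"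
      using pick_in_set_le card_pick_le by blast+
    with S have "pick S j < dim_col M" by auto
    with submatrix_index_card[OF i(2) this i(1) j(1)] j
    show "?N $$ (?r, j) * v $ j = M $$ (i, pick S j) * extend_vec (dim_col M) S v $ pick S j"
      by (simp add: extend_vec_def)
  qed
  also have "\<dots> = (\<Sum>k\<in>S. M $$ (i, k) * extend_vec (dim_col M) S v $ k)"
    using bij by (rule sum.reindex_bij_betw)
  also have "\<dots> = (\<Sum>k<dim_col M. M $$ (i, k) * extend_vec (dim_col M) S v $ k)"
    using S by (intro sum.mono_neutral_left) (auto simp: extend_vec_def)
  also have "\<dots> = (M *\<^sub>v extend_vec (dim_col M) S v) $ i"
    using i by (simp add: scalar_prod_def atLeast0LessThan extend_vec_def)
  finally show "(?N *\<^sub>v v) $ ?r = (M *\<^sub>v extend_vec (dim_col M) S v) $ i" .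
qed

lemma submatrix_kernel_extend_vec:
  fixes M :: "'a::semiring_0 mat"
  assumes "S \<subseteq> {..<dim_col M}" "v \<in> carrier_vec (card S)"
    and "submatrix M I S *\<^sub>v v = 0\<^sub>v (dim_row (submatrix M I S))"
    and "i \<in> I" "i < dim_row M"
  shows "(M *\<^sub>v extend_vec (dim_col M) S v) $ i = 0"
  using submatrix_mult_vec_index[OF assms(1,2,4,5)] assms(3) by simp

lemma append_vec_eq_zero:
  assumes "u \<in> carrier_vec p" "w \<in> carrier_vec q" "u @\<^sub>v w = 0\<^sub>v (p + q)"
  shows "u = 0\<^sub>v p" "w = 0\<^sub>v q"
proof -
  have "u @\<^sub>v w = 0\<^sub>v p @\<^sub>v 0\<^sub>v q"
    unfolding assms(3) by auto
  then show "u = 0\<^sub>v p" "w = 0\<^sub>v q"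
    using append_vec_eq[OF assms(1) zero_carrier_vec] by auto
qed

section \<open>Optimal solutions\<close>

lemma supp_carrier: "x \<in> carrier_vec n \<Longrightarrow> supp x \<subseteq> {..<n}"
  by (auto simp: supp_def)

lemma finite_supp: "finite (supp x)"
  by (simp add: supp_def)

lemma P0_solutionD:
  assumes "P0_solution A B y b \<epsilon> x"
  shows "x \<in> feasible A B y b \<epsilon>"
    and "\<And>z. z \<in> feasible A B y b \<epsilon> \<Longrightarrow> l0_norm x \<le> l0_norm z"
  using assms by (auto simp: P0_solution_def is_arg_min_def not_less)

text \<open>A smaller support cannot increase the number of nonzero entries, so \<open>z\<close> is
  again a minimizer and attains the infimum.\<close>

lemma P0_solution_optimalI:
  assumes "P0_solution A B y b \<epsilon> x" "z \<in> feasible A B y b \<epsilon>" "supp z \<subseteq> supp x"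
  shows "z \<in> optimal_set A B y b \<epsilon>"
proof -
  have "l0_norm z \<le> l0_norm x"
    unfolding l0_norm_def using assms(3) by (intro card_mono finite_supp)
  with P0_solutionD[OF assms(1)] assms(2) have min: "l0_norm z \<le> l0_norm w"
    if "w \<in> feasible A B y b \<epsilon>" for w
    using that by (meson order_trans)
  have "P0_value A B y b \<epsilon> = l0_norm z"
    unfolding P0_value_def using assms(2) min by (intro cInf_eq_minimum) auto
  then show ?thesis using assms(2) by (simp add: optimal_set_def)
qed

text \<open>Moving along a kernel vector of \<open>A\<close> leaves the residual unchanged, so only
  the linear inequalities have to be checked.\<close>

lemma feasible_add_smult_iff:
  assumes A: "A \<in> carrier_mat m n" and B: "B \<in> carrier_mat l n"
    and y: "y \<in> carrier_vec m" and b: "b \<in> carrier_vec l"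
    and x: "x \<in> feasible A B y b \<epsilon>" and e: "e \<in> carrier_vec n" "A *\<^sub>v e = 0\<^sub>v m"
  shows "x + t \<cdot>\<^sub>v e \<in> feasible A B y b \<epsilon>
    \<longleftrightarrow> (\<forall>j<l. (B *\<^sub>v x) $ j + t * (B *\<^sub>v e) $ j \<le> b $ j)"
proof -
  have xc: "x \<in> carrier_vec n" using x A by (simp add: feasible_def)
  have "A *\<^sub>v (x + t \<cdot>\<^sub>v e) = A *\<^sub>v x"
    using A xc e by (auto simp: mult_add_distrib_mat_vec[of _ m n] mult_mat_vec[of _ m n])
  moreover have "B *\<^sub>v (x + t \<cdot>\<^sub>v e) = B *\<^sub>v x + t \<cdot>\<^sub>v (B *\<^sub>v e)"
    using B xc e by (simp add: mult_add_distrib_mat_vec[of _ l n] mult_mat_vec[of _ l n])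
  ultimately show ?thesis
    using A B b x xc e
    by (auto simp: feasible_def less_eq_vec_def simp del: index_mult_mat_vec)
qed

text \<open>The step length is the smallest ratio of slack to increase among the constraints along which
  \<open>B *\<^sub>v e\<close> is positive.\<close>

lemma feasible_ray_exit:
  assumes A: "A \<in> carrier_mat m n" and B: "B \<in> carrier_mat l n"
    and y: "y \<in> carrier_vec m" and b: "b \<in> carrier_vec l"
    and x: "x \<in> feasible A B y b \<epsilon>" and e: "e \<in> carrier_vec n" "A *\<^sub>v e = 0\<^sub>v m"
    and act: "\<And>j. j \<in> active B b x \<Longrightarrow> (B *\<^sub>v e) $ j = 0"
    and infeas: "x + e \<notin> feasible A B y b \<epsilon>"
  obtains t where "x + t \<cdot>\<^sub>v e \<in> feasible A B y b \<epsilon>"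
    and "active B b x \<subset> active B b (x + t \<cdot>\<^sub>v e)"
proof -
  have xc: "x \<in> carrier_vec n" using x A by (simp add: feasible_def)
  have le: "(B *\<^sub>v x) $ j \<le> b $ j" if "j < l" for j
    using x B b that by (auto simp: feasible_def less_eq_vec_def)
  have Bt: "(B *\<^sub>v (x + t \<cdot>\<^sub>v e)) $ j = (B *\<^sub>v x) $ j + t * (B *\<^sub>v e) $ j" if "j < l" for t j
    using B xc e that
    by (simp add: mult_add_distrib_mat_vec[of _ l n] mult_mat_vec[of _ l n])
  define J where "J = {j. j < l \<and> (B *\<^sub>v e) $ j > 0}"
  define r where "r j = (b $ j - (B *\<^sub>v x) $ j) / (B *\<^sub>v e) $ j" for j
  have "x + 1 \<cdot>\<^sub>v e \<notin> feasible A B y b \<epsilon>" using infeas by simp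
  \<comment> \<open>A constraint violated at \<open>x + e\<close> but satisfied at \<open>x\<close>
    must increase along \<open>e\<close>; thus \<open>J\<close> is nonempty and a smallest ratio
    exists.\<close>
  then obtain j0 where "j0 < l" "(B *\<^sub>v x) $ j0 + (B *\<^sub>v e) $ j0 > b $ j0"
    using feasible_add_smult_iff[OF A B y b x e, of 1] by (auto simp: not_le)
  with le[of j0] have "j0 \<in> J" by (auto simp: J_def)
  moreover have "finite J" by (simp add: J_def)
  ultimately obtain k where k: "k \<in> J" "\<And>j. j \<in> J \<Longrightarrow> r k \<le> r j"
    using arg_min_if_finite(1,2)[of J r] by (metis empty_iff not_le)
  have kl: "k < l" and kpos: "(B *\<^sub>v e) $ k > 0" using k by (auto simp: J_def)
  have rk: "r k \<ge> 0" using kpos le[OF kl] by (simp add: r_def)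
  show ?thesis
  proof (rule that[of "r k"])
    have "(B *\<^sub>v x) $ j + r k * (B *\<^sub>v e) $ j \<le> b $ j" if "j < l" for j
    proof (cases "(B *\<^sub>v e) $ j > 0")
      case True
      with that k(2)[of j] have "r k \<le> r j" by (simp add: J_def)
      then show ?thesis using True by (simp add: r_def pos_le_divide_eq)
    next
      case False
      then have "r k * (B *\<^sub>v e) $ j \<le> 0" using rk by (simp add: mult_nonneg_nonpos)
      then show ?thesis using le[OF that] by simp
    qed
    then show "x + r k \<cdot>\<^sub>v e \<in> feasible A B y b \<epsilon>"
      by (simp add: feasible_add_smult_iff[OF A B y b x e])
    have "active B b x \<subseteq> active B b (x + r k \<cdot>\<^sub>v e)"
      using B act Bt by (auto simp: active_def simp del: index_mult_mat_vec)
    \<comment> \<open>The step \<open>r k\<close> uses up exactly the slack of constraint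
      \<open>k\<close>.\<close>
    moreover have "k \<in> active B b (x + r k \<cdot>\<^sub>v e)"
      using kl kpos B Bt[OF kl] by (simp add: active_def r_def del: index_mult_mat_vec)
    moreover have "k \<notin> active B b x" using act kpos by force
    ultimately show "active B b x \<subset> active B b (x + r k \<cdot>\<^sub>v e)" by blast
  qed
qed

lemma exists_more_active_optimal:
  assumes A: "A \<in> carrier_mat m n" and B: "B \<in> carrier_mat l n"
    and y: "y \<in> carrier_vec m" and b: "b \<in> carrier_vec l"
    and sol: "P0_solution A B y b \<epsilon> x"
    and d: "d \<in> carrier_vec n" "A *\<^sub>v d = 0\<^sub>v m" "supp d \<subseteq> supp x" "supp d \<noteq> {}"
    and act: "\<And>j. j \<in> active B b x \<Longrightarrow> (B *\<^sub>v d) $ j = 0"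
  obtains z where "z \<in> optimal_set A B y b \<epsilon>" "active B b x \<subset> active B b z"
proof -
  note x = P0_solutionD(1)[OF sol]
  have xc: "x \<in> carrier_vec n" using x A by (simp add: feasible_def)
  obtain i where i: "i \<in> supp d" using d(4) by blast
  then have ix: "i \<in> supp x" and i': "i < n" "d $ i \<noteq> 0" using d by (auto simp: supp_def)
  \<comment> \<open>The factor is chosen so that entry \<open>i\<close> of \<open>x + e\<close>
    vanishes.\<close>
  define e where "e = (- (x $ i) / d $ i) \<cdot>\<^sub>v d"
  have e: "e \<in> carrier_vec n" "A *\<^sub>v e = 0\<^sub>v m"
    using A d(1,2) by (auto simp: e_def mult_mat_vec[of _ m n])
  have Be: "(B *\<^sub>v e) $ j = 0" if "j \<in> active B b x" for j
    using act[OF that] that B d(1)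
    by (auto simp: e_def active_def mult_mat_vec[of _ l n] simp del: index_mult_mat_vec)
  \<comment> \<open>This is needed for all \<open>t\<close>, since the step length at the exit point
    is not known in advance.\<close>
  have sub: "supp (x + t \<cdot>\<^sub>v e) \<subseteq> supp x" for t
    using d(1,3) xc by (auto simp: supp_def e_def)
  have "supp (x + e) \<subseteq> supp x - {i}"
    using sub[of 1] i' e(1) d(1) xc by (auto simp: supp_def e_def)
  then have "supp (x + e) \<subset> supp x" using ix by blast
  then have "l0_norm (x + e) < l0_norm x"
    unfolding l0_norm_def by (intro psubset_card_mono finite_supp)
  then have "x + e \<notin> feasible A B y b \<epsilon>"
    using P0_solutionD(2)[OF sol] by (meson not_le)
  then obtain t where "x + t \<cdot>\<^sub>v e \<in> feasible A B y b \<epsilon>"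
      and "active B b x \<subset> active B b (x + t \<cdot>\<^sub>v e)"
    using feasible_ray_exit[OF A B y b x e Be] by blast
  then show ?thesis using that P0_solution_optimalI[OF sol _ sub] by blast
qed

theorem theorem2p2:
  fixes A B :: "real mat" and y b xs :: "real vec" and \<epsilon> :: real
    and m n l :: nat and S I :: "nat set"
  assumes "A \<in> carrier_mat m n" and "B \<in> carrier_mat l n"
    and "y \<in> carrier_vec m" and "b \<in> carrier_vec l"
    and "m < n" and "l \<le> n" and "0 \<le> \<epsilon>"
    and "P0_solution A B y b \<epsilon> xs"
    and "S = supp xs" and "I = active B b xs"
    and "card I = Max ((\<lambda>x. card (active B b x)) ` optimal_set A B y b \<epsilon>)"
  shows "full_column_rank (submatrix A UNIV S @\<^sub>r submatrix B I S)"
proof (rule full_column_rankI, rule ccontr)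
  note A = assms(1) and B = assms(2)
  let ?A = "submatrix A UNIV S" and ?B = "submatrix B I S"
  have "xs \<in> carrier_vec n"
    using P0_solutionD(1)[OF assms(8)] A by (simp add: feasible_def)
  then have S: "S \<subseteq> {..<n}" using supp_carrier assms(9) by simp
  then have SA: "S \<subseteq> {..<dim_col A}" and SB: "S \<subseteq> {..<dim_col B}" using A B by auto
  have A': "?A \<in> carrier_mat (dim_row ?A) (card S)"
    using dim_col_submatrix_subset[OF SA] by (intro carrier_matI) simp_all
  have B': "?B \<in> carrier_mat (dim_row ?B) (card S)"
    using dim_col_submatrix_subset[OF SB] by (intro carrier_matI) simp_all
  have M: "?A @\<^sub>r ?B \<in> carrier_mat (dim_row ?A + dim_row ?B) (card S)"
    using A' B' by (rule carrier_append_rows)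
  fix v
  assume "v \<in> carrier_vec (dim_col (?A @\<^sub>r ?B))" "v \<noteq> 0\<^sub>v (dim_col (?A @\<^sub>r ?B))"
    and ker: "(?A @\<^sub>r ?B) *\<^sub>v v = 0\<^sub>v (dim_row (?A @\<^sub>r ?B))"
  with M have v: "v \<in> carrier_vec (card S)" "v \<noteq> 0\<^sub>v (card S)" by auto
  have "(?A *\<^sub>v v) @\<^sub>v (?B *\<^sub>v v) = 0\<^sub>v (dim_row ?A + dim_row ?B)"
    using ker mat_mult_append[OF A' B' v(1)] carrier_matD(1)[OF M] by metis
  then have kA: "?A *\<^sub>v v = 0\<^sub>v (dim_row ?A)" and kB: "?B *\<^sub>v v = 0\<^sub>v (dim_row ?B)"
    using append_vec_eq_zero[OF mult_mat_vec_carrier[OF A' v(1)] mult_mat_vec_carrier[OF B' v(1)]]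
    by blast+
  define d where "d = extend_vec n S v"
  have d: "d \<in> carrier_vec n" by (simp add: d_def)
  \<comment> \<open>The row set \<open>UNIV\<close> keeps all rows of \<open>A\<close>, so every
    entry of the product vanishes; for \<open>B\<close> only the active rows are available.\<close>
  have "A *\<^sub>v d = 0\<^sub>v m"
    using submatrix_kernel_extend_vec[OF SA v(1) kA] A
    by (intro eq_vecI) (auto simp: d_def simp del: index_mult_mat_vec)
  moreover have "supp d \<subseteq> supp xs"
    unfolding d_def assms(9)[symmetric] by (rule supp_extend_vec_subset)
  moreover have "supp d \<noteq> {}"
    unfolding d_def using S v by (rule supp_extend_vec_nonempty)
  moreover have "(B *\<^sub>v d) $ j = 0" if "j \<in> active B b xs" for j
    using submatrix_kernel_extend_vec[OF SB v(1) kB, of j] B that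
    by (simp add: d_def assms(10) active_def del: index_mult_mat_vec)
  ultimately obtain z where z: "z \<in> optimal_set A B y b \<epsilon>" "I \<subset> active B b z"
    using exists_more_active_optimal[OF assms(1-4,8) d] assms(10) by metis
  \<comment> \<open>\<open>optimal_set\<close> may be infinite, but the cardinalities are bounded by
    \<open>l\<close>. So their set is finite and \<open>Max\<close> is an upper bound for
    it.\<close>
  have fin: "finite (active B b x)" and le: "card (active B b x) \<le> l" for x
  proof -
    have "active B b x \<subseteq> {..<l}" using B by (auto simp: active_def)
    from finite_subset[OF this] card_mono[OF _ this]
    show "finite (active B b x)" "card (active B b x) \<le> l" by simp_all
  qed
  have "(\<lambda>x. card (active B b x)) ` optimal_set A B y b \<epsilon> \<subseteq> {..l}"
    by (rule image_subsetI) (simp only: atMost_iff le)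
  then have "finite ((\<lambda>x. card (active B b x)) ` optimal_set A B y b \<epsilon>)"
    by (rule finite_subset) (rule finite_atMost)
  from Max_ge[OF this imageI[OF z(1)]] have "card (active B b z) \<le> card I"
    by (simp only: assms(11))
  moreover have "card I < card (active B b z)"
    by (rule psubset_card_mono[OF fin z(2)])
  ultimately show False by simp
qed

end
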